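(* Let $R$ be a ring, let $E$ be a Euclidean $R$-bimodule and let $a_1,\ldots,a_n\in E$. Then for an element $l\in E$ the following statements are equivalent: (1) $l=\mathrm{lcm}_b(a_1,\ldots,a_n)$, i.e. $l$ is a bimodule least common multiple of $a_1,\ldots,a_n$. (2) For each $i=1,\ldots,n$, $l\in Ra_iR$, and if a cyclic element $l'\in E$ satisfies the same condition (i.e. $l'\in Ra_iR$ for each $i=1,\ldots,n$) then $l'=\alpha l$ for some $\alpha\in R$.
   Context: Rings are unital. A poset is Artinian if every descending chain in it stabilizes. A left $R$-module $E$ is Euclidean with Euclidean function $d_E:E\setminus\{0\}\to P$, $P$ a poset, if $\mathrm{im}(d_E)$ is an Artinian poset and, for any nonzero $u,v\in E$, there are $q\in R$, $r\in E$ with $u=qv+r$ and either $r=0$ or $d_E(r)<d_E(v)$. Right Euclidean modules are defined in the same way with $u=vq+r$. An $R$-bimodule $(E,d_E)$ is a Euclidean $R$-bimodule if both $({}_RE,d_E)$ and $(E_R,d_E)$ are Euclidean (with the same $d_E$). An element $c\in E$ is cyclic if $Rc=cR$. A bimodule $N$ is cyclic if $N=Re=eR$ for some $e\in N$, called a cyclic generator; every sub-bimodule of a Euclidean bimodule is cyclic. $Ra_iR$ denotes the sub-bimodule of $E$ generated by $a_i$. A bimodule least common multiple $\mathrm{lcm}_b(a_1,\ldots,a_n)$ is any cyclic generator of the sub-bimodule $\bigcap_{i=1}^nRa_iR$; "$l=\mathrm{lcm}_b(a_1,\ldots,a_n)$" means that $l$ is such a generator. *)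

theory Defs
  imports "HOL-Algebra.Algebra"
begin

text \<open>
  The library locale \<open>module\<close> requires a commutative ring of scalars, so one-sided modules and
  bimodules over an arbitrary unital ring are introduced here. As for \<open>module\<close>, the record
  inherits the fields \<open>mult\<close> and \<open>one\<close> from \<open>ring\<close>; they carry no meaning for a bimodule.
\<close>

record ('a, 'b) bimodule = "('a, 'b) module" +
  rsmult :: "['b, 'a] \<Rightarrow> 'b" (infixl \<open>\<odot>\<^sub>r\<index>\<close> 70)

locale left_module = R?: ring R + M?: abelian_group M
  for R :: "('a, 'r) ring_scheme" (structure) and M :: "('a, 'b, 'm) module_scheme" (structure) +
  assumes lsmult_closed:
      "\<lbrakk>a \<in> carrier R; x \<in> carrier M\<rbrakk> \<Longrightarrow> a \<odot>\<^bsub>M\<^esub> x \<in> carrier M"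
    and lsmult_l_distr:
      "\<lbrakk>a \<in> carrier R; b \<in> carrier R; x \<in> carrier M\<rbrakk> \<Longrightarrow>
        (a \<oplus>\<^bsub>R\<^esub> b) \<odot>\<^bsub>M\<^esub> x = a \<odot>\<^bsub>M\<^esub> x \<oplus>\<^bsub>M\<^esub> b \<odot>\<^bsub>M\<^esub> x"
    and lsmult_r_distr:
      "\<lbrakk>a \<in> carrier R; x \<in> carrier M; y \<in> carrier M\<rbrakk> \<Longrightarrow>
        a \<odot>\<^bsub>M\<^esub> (x \<oplus>\<^bsub>M\<^esub> y) = a \<odot>\<^bsub>M\<^esub> x \<oplus>\<^bsub>M\<^esub> a \<odot>\<^bsub>M\<^esub> y"
    and lsmult_assoc:
      "\<lbrakk>a \<in> carrier R; b \<in> carrier R; x \<in> carrier M\<rbrakk> \<Longrightarrow>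
        (a \<otimes>\<^bsub>R\<^esub> b) \<odot>\<^bsub>M\<^esub> x = a \<odot>\<^bsub>M\<^esub> (b \<odot>\<^bsub>M\<^esub> x)"
    and lsmult_one:
      "x \<in> carrier M \<Longrightarrow> \<one>\<^bsub>R\<^esub> \<odot>\<^bsub>M\<^esub> x = x"

locale right_module = R?: ring R + M?: abelian_group M
  for R :: "('a, 'r) ring_scheme" (structure) and M :: "('a, 'b, 'm) bimodule_scheme" (structure) +
  assumes rsmult_closed:
      "\<lbrakk>x \<in> carrier M; a \<in> carrier R\<rbrakk> \<Longrightarrow> x \<odot>\<^sub>r\<^bsub>M\<^esub> a \<in> carrier M"
    and rsmult_r_distr:
      "\<lbrakk>x \<in> carrier M; a \<in> carrier R; b \<in> carrier R\<rbrakk> \<Longrightarrow>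
        x \<odot>\<^sub>r\<^bsub>M\<^esub> (a \<oplus>\<^bsub>R\<^esub> b) = x \<odot>\<^sub>r\<^bsub>M\<^esub> a \<oplus>\<^bsub>M\<^esub> x \<odot>\<^sub>r\<^bsub>M\<^esub> b"
    and rsmult_l_distr:
      "\<lbrakk>x \<in> carrier M; y \<in> carrier M; a \<in> carrier R\<rbrakk> \<Longrightarrow>
        (x \<oplus>\<^bsub>M\<^esub> y) \<odot>\<^sub>r\<^bsub>M\<^esub> a = x \<odot>\<^sub>r\<^bsub>M\<^esub> a \<oplus>\<^bsub>M\<^esub> y \<odot>\<^sub>r\<^bsub>M\<^esub> a"
    and rsmult_assoc:
      "\<lbrakk>x \<in> carrier M; a \<in> carrier R; b \<in> carrier R\<rbrakk> \<Longrightarrow>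
        x \<odot>\<^sub>r\<^bsub>M\<^esub> (a \<otimes>\<^bsub>R\<^esub> b) = (x \<odot>\<^sub>r\<^bsub>M\<^esub> a) \<odot>\<^sub>r\<^bsub>M\<^esub> b"
    and rsmult_one:
      "x \<in> carrier M \<Longrightarrow> x \<odot>\<^sub>r\<^bsub>M\<^esub> \<one>\<^bsub>R\<^esub> = x"

locale bimodule = left_module R M + right_module R M
  for R :: "('a, 'r) ring_scheme" (structure) and M :: "('a, 'b, 'm) bimodule_scheme" (structure) +
  assumes smult_rsmult_assoc:
    "\<lbrakk>a \<in> carrier R; x \<in> carrier M; b \<in> carrier R\<rbrakk> \<Longrightarrow>
      (a \<odot>\<^bsub>M\<^esub> x) \<odot>\<^sub>r\<^bsub>M\<^esub> b = a \<odot>\<^bsub>M\<^esub> (x \<odot>\<^sub>r\<^bsub>M\<^esub> b)"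

definition artinian_poset :: "'p::order set \<Rightarrow> bool" where
  "artinian_poset P \<longleftrightarrow>
    (\<forall>f :: nat \<Rightarrow> 'p. range f \<subseteq> P \<and> decseq f \<longrightarrow> (\<exists>N. \<forall>n\<ge>N. f n = f N))"

text \<open>The value of a Euclidean function at zero is irrelevant.\<close>

locale left_euclidean_module = left_module R M
  for R :: "('a, 'r) ring_scheme" (structure) and M :: "('a, 'b, 'm) module_scheme" (structure) +
  fixes d :: "'b \<Rightarrow> 'p::order"
  assumes left_artinian: "artinian_poset (d ` (carrier M - {\<zero>\<^bsub>M\<^esub>}))"
    and left_division:
      "\<lbrakk>u \<in> carrier M - {\<zero>\<^bsub>M\<^esub>}; v \<in> carrier M - {\<zero>\<^bsub>M\<^esub>}\<rbrakk> \<Longrightarrow>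
        \<exists>q \<in> carrier R. \<exists>r \<in> carrier M.
          u = q \<odot>\<^bsub>M\<^esub> v \<oplus>\<^bsub>M\<^esub> r \<and> (r = \<zero>\<^bsub>M\<^esub> \<or> d r < d v)"

locale right_euclidean_module = right_module R M
  for R :: "('a, 'r) ring_scheme" (structure) and M :: "('a, 'b, 'm) bimodule_scheme" (structure) +
  fixes d :: "'b \<Rightarrow> 'p::order"
  assumes right_artinian: "artinian_poset (d ` (carrier M - {\<zero>\<^bsub>M\<^esub>}))"
    and right_division:
      "\<lbrakk>u \<in> carrier M - {\<zero>\<^bsub>M\<^esub>}; v \<in> carrier M - {\<zero>\<^bsub>M\<^esub>}\<rbrakk> \<Longrightarrow>
        \<exists>q \<in> carrier R. \<exists>r \<in> carrier M.
          u = v \<odot>\<^sub>r\<^bsub>M\<^esub> q \<oplus>\<^bsub>M\<^esub> r \<and> (r = \<zero>\<^bsub>M\<^esub> \<or> d r < d v)"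

locale euclidean_bimodule =
  bimodule R E + left_euclidean_module R E d + right_euclidean_module R E d
  for R :: "('a, 'r) ring_scheme" (structure) and E :: "('a, 'b, 'm) bimodule_scheme" (structure)
    and d :: "'b \<Rightarrow> 'p::order"

locale subbimodule = submodule H R M
  for H and R :: "('a, 'r) ring_scheme" and M :: "('a, 'b, 'm) bimodule_scheme" (structure) +
  assumes rsmult_closed: "\<lbrakk>x \<in> H; a \<in> carrier R\<rbrakk> \<Longrightarrow> x \<odot>\<^sub>r\<^bsub>M\<^esub> a \<in> H"

text \<open>The sub-bimodule \<open>RaR\<close> generated by \<open>a\<close>.\<close>

definition gen_subbimodule ::
  "('a, 'r) ring_scheme \<Rightarrow> ('a, 'b, 'm) bimodule_scheme \<Rightarrow> 'b \<Rightarrow> 'b set" where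
  "gen_subbimodule R M a = \<Inter> {H. subbimodule H R M \<and> a \<in> H}"

definition left_multiples ::
  "('a, 'r) ring_scheme \<Rightarrow> ('a, 'b, 'm) module_scheme \<Rightarrow> 'b \<Rightarrow> 'b set" where
  "left_multiples R M c = {r \<odot>\<^bsub>M\<^esub> c | r. r \<in> carrier R}"

definition right_multiples ::
  "('a, 'r) ring_scheme \<Rightarrow> ('a, 'b, 'm) bimodule_scheme \<Rightarrow> 'b \<Rightarrow> 'b set" where
  "right_multiples R M c = {c \<odot>\<^sub>r\<^bsub>M\<^esub> r | r. r \<in> carrier R}"

definition cyclic_element ::
  "('a, 'r) ring_scheme \<Rightarrow> ('a, 'b, 'm) bimodule_scheme \<Rightarrow> 'b \<Rightarrow> bool" where
  "cyclic_element R M c \<longleftrightarrow> c \<in> carrier M \<and> left_multiples R M c = right_multiples R M c"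

definition cyclic_generator ::
  "('a, 'r) ring_scheme \<Rightarrow> ('a, 'b, 'm) bimodule_scheme \<Rightarrow> 'b set \<Rightarrow> 'b \<Rightarrow> bool" where
  "cyclic_generator R M N e \<longleftrightarrow>
    e \<in> N \<and> N = left_multiples R M e \<and> N = right_multiples R M e"

text \<open>
  Bimodule least common multiples are not unique, so "\<open>l = lcm\<^sub>b(a\<^sub>1, \<dots>, a\<^sub>n)\<close>" is a relation
  between the family and \<open>l\<close>.
\<close>

definition is_bimodule_lcm ::
  "('a, 'r) ring_scheme \<Rightarrow> ('a, 'b, 'm) bimodule_scheme \<Rightarrow> nat \<Rightarrow> (nat \<Rightarrow> 'b) \<Rightarrow> 'b \<Rightarrow> bool" where
  "is_bimodule_lcm R M n a l \<longleftrightarrow>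
    cyclic_generator R M (\<Inter>i\<in>{1..n}. gen_subbimodule R M (a i)) l"

end

theory Submission
  imports Defs
begin

text \<open>
  The intersection \<open>N\<close> of the sub-bimodules \<open>Ra\<^sub>iR\<close> is generated on both sides by any of its
  nonzero elements \<open>g\<close> of minimal Euclidean value. If \<open>l\<close> satisfies (2), then \<open>g = \<alpha>l\<close>, so
  \<open>N = Rl\<close>; the point is to show \<open>N = lR\<close>. Writing \<open>l = \<beta>g\<close>, the product \<open>\<alpha>\<beta>\<close> fixes \<open>g\<close> and hence
  acts as the identity on \<open>N = gR\<close>. Thus left multiplication by \<open>\<alpha>\<close> is a surjective endomorphism
  of the Noetherian right module \<open>N\<close>, hence injective, and left multiplication by \<open>\<beta>\<close> is its
  inverse. In particular \<open>lR = \<beta>gR = \<beta>N = N\<close>.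
\<close>

section \<open>Minimal elements in Artinian posets\<close>

text \<open>If every element of \<open>S\<close> had another of strictly smaller value, dependent
  choice would produce a strictly decreasing sequence of values, which never stabilizes. The order
  is only partial, so the outcome is a minimal element and not a least one.\<close>

lemma artinian_poset_minimal:
  assumes "artinian_poset (d ` A)" "S \<subseteq> A" "S \<noteq> {}"
  shows "\<exists>m\<in>S. \<forall>x\<in>S. \<not> d x < d m"
proof (rule ccontr)
  assume "\<not> ?thesis"
  then have less: "\<forall>m\<in>S. \<exists>x\<in>S. d x < d m" by blast
  have "\<exists>f. \<forall>n :: nat. f n \<in> S \<and> d (f (Suc n)) < d (f n)"
  proof (rule dependent_nat_choice)
    show "\<exists>x. x \<in> S" using \<open>S \<noteq> {}\<close> by blast
    show "\<exists>y. y \<in> S \<and> d y < d x" if "x \<in> S" for x n using less that by blast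
  qed
  then obtain f where f: "\<And>n :: nat. f n \<in> S" "\<And>n. d (f (Suc n)) < d (f n)" by metis
  have "decseq (\<lambda>n. d (f n))" using f(2) by (simp add: decseq_Suc_iff less_imp_le)
  moreover have "range (\<lambda>n. d (f n)) \<subseteq> d ` A" using f(1) \<open>S \<subseteq> A\<close> by blast
  ultimately have "\<exists>N. \<forall>n\<ge>N. d (f n) = d (f N)"
    using \<open>artinian_poset (d ` A)\<close> unfolding artinian_poset_def by simp
  then obtain N where "\<forall>n\<ge>N. d (f n) = d (f N)" ..
  then have "d (f (Suc N)) = d (f N)" using le_SucI[OF order_refl] by blast
  with f(2)[of N] show False by simp
qed

section \<open>Multiples of zero\<close>

lemma (in left_module) lsmult_zero:
  assumes "a \<in> carrier R" shows "a \<odot>\<^bsub>M\<^esub> \<zero>\<^bsub>M\<^esub> = \<zero>\<^bsub>M\<^esub>"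
proof -
  have "a \<odot>\<^bsub>M\<^esub> \<zero>\<^bsub>M\<^esub> = a \<odot>\<^bsub>M\<^esub> \<zero>\<^bsub>M\<^esub> \<oplus>\<^bsub>M\<^esub> a \<odot>\<^bsub>M\<^esub> \<zero>\<^bsub>M\<^esub>"
    using lsmult_r_distr[OF assms, of "\<zero>\<^bsub>M\<^esub>" "\<zero>\<^bsub>M\<^esub>"] by simp
  then show ?thesis
    using M.add.l_cancel_one'[of "a \<odot>\<^bsub>M\<^esub> \<zero>\<^bsub>M\<^esub>" "a \<odot>\<^bsub>M\<^esub> \<zero>\<^bsub>M\<^esub>"] lsmult_closed[OF assms] by simp
qed

text \<open>Together with its right-hand counterpart, this settles the zero submodule, where there
  is no nonzero element of minimal value to choose.\<close>

lemma (in left_module) left_multiples_zero: "left_multiples R M \<zero>\<^bsub>M\<^esub> = {\<zero>\<^bsub>M\<^esub>}"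
proof -
  have "left_multiples R M \<zero>\<^bsub>M\<^esub> = (\<lambda>a. a \<odot>\<^bsub>M\<^esub> \<zero>\<^bsub>M\<^esub>) ` carrier R"
    unfolding left_multiples_def by blast
  also have "\<dots> = (\<lambda>_. \<zero>\<^bsub>M\<^esub>) ` carrier R" by (rule image_cong) (simp_all add: lsmult_zero)
  also have "\<dots> = {\<zero>\<^bsub>M\<^esub>}" using R.zero_closed by blast
  finally show ?thesis .
qed

lemma (in right_module) rsmult_zero:
  assumes "a \<in> carrier R" shows "\<zero>\<^bsub>M\<^esub> \<odot>\<^sub>r\<^bsub>M\<^esub> a = \<zero>\<^bsub>M\<^esub>"
proof -
  have "\<zero>\<^bsub>M\<^esub> \<odot>\<^sub>r\<^bsub>M\<^esub> a = \<zero>\<^bsub>M\<^esub> \<odot>\<^sub>r\<^bsub>M\<^esub> a \<oplus>\<^bsub>M\<^esub> \<zero>\<^bsub>M\<^esub> \<odot>\<^sub>r\<^bsub>M\<^esub> a"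
    using rsmult_l_distr[OF _ _ assms, of "\<zero>\<^bsub>M\<^esub>" "\<zero>\<^bsub>M\<^esub>"] by simp
  then show ?thesis
    using M.add.l_cancel_one'[of "\<zero>\<^bsub>M\<^esub> \<odot>\<^sub>r\<^bsub>M\<^esub> a" "\<zero>\<^bsub>M\<^esub> \<odot>\<^sub>r\<^bsub>M\<^esub> a"] rsmult_closed[OF _ assms] by simp
qed

lemma (in right_module) right_multiples_zero: "right_multiples R M \<zero>\<^bsub>M\<^esub> = {\<zero>\<^bsub>M\<^esub>}"
proof -
  have "right_multiples R M \<zero>\<^bsub>M\<^esub> = (\<lambda>a. \<zero>\<^bsub>M\<^esub> \<odot>\<^sub>r\<^bsub>M\<^esub> a) ` carrier R"
    unfolding right_multiples_def by blast
  also have "\<dots> = (\<lambda>_. \<zero>\<^bsub>M\<^esub>) ` carrier R" by (rule image_cong) (simp_all add: rsmult_zero)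
  also have "\<dots> = {\<zero>\<^bsub>M\<^esub>}" using R.zero_closed by blast
  finally show ?thesis .
qed

section \<open>Euclidean division and principal submodules\<close>

text \<open>Adding \<open>\<ominus> x\<close> to the sum recovers \<open>r\<close>. In Euclidean
  division this keeps the remainder inside the submodule.\<close>

lemma (in abelian_group) summand_in_subgroup:
  assumes H: "subgroup H (add_monoid G)" and x: "x \<in> H" and r: "r \<in> carrier G"
    and sum: "x \<oplus> r \<in> H"
  shows "r \<in> H"
proof -
  have xc: "x \<in> carrier G" using subgroup.subset[OF H] x by auto
  have "\<ominus> x \<oplus> (x \<oplus> r) \<in> H"
    using subgroup.m_closed[OF H add.subgroupE(3)[OF H x] sum] by simp
  then show ?thesis using r_neg1[OF xc r] by simp
qed

text \<open>Dividing an element of \<open>H\<close> by \<open>v\<close> leaves a remainder that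
  again lies in \<open>H\<close>. Minimality of \<open>v\<close> excludes a smaller value, so the
  remainder is zero.\<close>

lemma (in left_euclidean_module) minimal_left_generates:
  assumes H: "subgroup H (add_monoid M)"
    and closed: "\<And>a x. \<lbrakk>a \<in> carrier R; x \<in> H\<rbrakk> \<Longrightarrow> a \<odot>\<^bsub>M\<^esub> x \<in> H"
    and v: "v \<in> H" "v \<noteq> \<zero>\<^bsub>M\<^esub>"
    and min: "\<And>x. \<lbrakk>x \<in> H; x \<noteq> \<zero>\<^bsub>M\<^esub>\<rbrakk> \<Longrightarrow> \<not> d x < d v"
  shows "H = left_multiples R M v"
proof
  show "left_multiples R M v \<subseteq> H" unfolding left_multiples_def using closed v(1) by auto
  have sub: "H \<subseteq> carrier M" using subgroup.subset[OF H] by simp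
  show "H \<subseteq> left_multiples R M v"
  proof
    fix u assume u: "u \<in> H"
    have "\<exists>q\<in>carrier R. u = q \<odot>\<^bsub>M\<^esub> v"
    \<comment> \<open>Division is available only for nonzero \<open>u\<close>; zero is obtained as
      the multiple of \<open>v\<close> by the zero scalar.\<close>
    proof (cases "u = \<zero>\<^bsub>M\<^esub>")
      case True
      have "\<zero>\<^bsub>R\<^esub> \<odot>\<^bsub>M\<^esub> v = \<zero>\<^bsub>R\<^esub> \<odot>\<^bsub>M\<^esub> v \<oplus>\<^bsub>M\<^esub> \<zero>\<^bsub>R\<^esub> \<odot>\<^bsub>M\<^esub> v"
        using lsmult_l_distr[of "\<zero>\<^bsub>R\<^esub>" "\<zero>\<^bsub>R\<^esub>" v] sub v(1) by auto
      then have "\<zero>\<^bsub>R\<^esub> \<odot>\<^bsub>M\<^esub> v = \<zero>\<^bsub>M\<^esub>"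
        using M.add.l_cancel_one'[of "\<zero>\<^bsub>R\<^esub> \<odot>\<^bsub>M\<^esub> v" "\<zero>\<^bsub>R\<^esub> \<odot>\<^bsub>M\<^esub> v"] lsmult_closed[of "\<zero>\<^bsub>R\<^esub>" v] sub v(1)
        by auto
      with True show ?thesis by (metis R.zero_closed)
    next
      case False
      then obtain q r where qr: "q \<in> carrier R" "r \<in> carrier M" "u = q \<odot>\<^bsub>M\<^esub> v \<oplus>\<^bsub>M\<^esub> r"
          "r = \<zero>\<^bsub>M\<^esub> \<or> d r < d v"
        using left_division[of u v] u v sub by blast
      have "r \<in> H"
        using M.summand_in_subgroup[OF H closed[OF qr(1) v(1)] qr(2)] qr(3) u by simp
      with min qr(4) have "r = \<zero>\<^bsub>M\<^esub>" by blast
      with qr v(1) sub show ?thesis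
        by (metis M.add.r_one lsmult_closed subsetD)
    qed
    then show "u \<in> left_multiples R M v" unfolding left_multiples_def by blast
  qed
qed

text \<open>The same division argument with the quotient on the right. The minimality condition on
  \<open>v\<close> is word for word that of the left version, so one element can serve both
  sides.\<close>

lemma (in right_euclidean_module) minimal_right_generates:
  assumes H: "subgroup H (add_monoid M)"
    and closed: "\<And>x a. \<lbrakk>x \<in> H; a \<in> carrier R\<rbrakk> \<Longrightarrow> x \<odot>\<^sub>r\<^bsub>M\<^esub> a \<in> H"
    and v: "v \<in> H" "v \<noteq> \<zero>\<^bsub>M\<^esub>"
    and min: "\<And>x. \<lbrakk>x \<in> H; x \<noteq> \<zero>\<^bsub>M\<^esub>\<rbrakk> \<Longrightarrow> \<not> d x < d v"
  shows "H = right_multiples R M v"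
proof
  show "right_multiples R M v \<subseteq> H" unfolding right_multiples_def using closed v(1) by auto
  have sub: "H \<subseteq> carrier M" using subgroup.subset[OF H] by simp
  show "H \<subseteq> right_multiples R M v"
  proof
    fix u assume u: "u \<in> H"
    have "\<exists>q\<in>carrier R. u = v \<odot>\<^sub>r\<^bsub>M\<^esub> q"
    proof (cases "u = \<zero>\<^bsub>M\<^esub>")
      case True
      have "v \<odot>\<^sub>r\<^bsub>M\<^esub> \<zero>\<^bsub>R\<^esub> = v \<odot>\<^sub>r\<^bsub>M\<^esub> \<zero>\<^bsub>R\<^esub> \<oplus>\<^bsub>M\<^esub> v \<odot>\<^sub>r\<^bsub>M\<^esub> \<zero>\<^bsub>R\<^esub>"
        using rsmult_r_distr[of v "\<zero>\<^bsub>R\<^esub>" "\<zero>\<^bsub>R\<^esub>"] sub v(1) by auto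
      then have "v \<odot>\<^sub>r\<^bsub>M\<^esub> \<zero>\<^bsub>R\<^esub> = \<zero>\<^bsub>M\<^esub>"
        using M.add.l_cancel_one'[of "v \<odot>\<^sub>r\<^bsub>M\<^esub> \<zero>\<^bsub>R\<^esub>" "v \<odot>\<^sub>r\<^bsub>M\<^esub> \<zero>\<^bsub>R\<^esub>"] rsmult_closed[of v "\<zero>\<^bsub>R\<^esub>"] sub v(1)
        by auto
      with True show ?thesis by (metis R.zero_closed)
    next
      case False
      then obtain q r where qr: "q \<in> carrier R" "r \<in> carrier M" "u = v \<odot>\<^sub>r\<^bsub>M\<^esub> q \<oplus>\<^bsub>M\<^esub> r"
          "r = \<zero>\<^bsub>M\<^esub> \<or> d r < d v"
        using right_division[of u v] u v sub by blast
      have "r \<in> H"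
        using M.summand_in_subgroup[OF H closed[OF v(1) qr(1)] qr(2)] qr(3) u by simp
      with min qr(4) have "r = \<zero>\<^bsub>M\<^esub>" by blast
      with qr v(1) sub show ?thesis
        by (metis M.add.r_one rsmult_closed subsetD)
    qed
    then show "u \<in> right_multiples R M v" unfolding right_multiples_def by blast
  qed
qed

text \<open>This principality takes the place of the ascending chain condition in the Hopfian
  argument below.\<close>

lemma (in right_euclidean_module) right_submodule_generator:
  assumes H: "subgroup H (add_monoid M)"
    and closed: "\<And>x a. \<lbrakk>x \<in> H; a \<in> carrier R\<rbrakk> \<Longrightarrow> x \<odot>\<^sub>r\<^bsub>M\<^esub> a \<in> H"
  shows "\<exists>v\<in>H. H = right_multiples R M v"
proof (cases "H = {\<zero>\<^bsub>M\<^esub>}")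
  case True
  then show ?thesis using right_multiples_zero by simp
next
  case False
  have "\<zero>\<^bsub>M\<^esub> \<in> H" using subgroup.one_closed[OF H] by simp
  with False have ne: "H - {\<zero>\<^bsub>M\<^esub>} \<noteq> {}" by auto
  have sub: "H - {\<zero>\<^bsub>M\<^esub>} \<subseteq> carrier M - {\<zero>\<^bsub>M\<^esub>}" using subgroup.subset[OF H] by auto
  obtain v where v: "v \<in> H - {\<zero>\<^bsub>M\<^esub>}" "\<forall>x\<in>H - {\<zero>\<^bsub>M\<^esub>}. \<not> d x < d v"
    using artinian_poset_minimal[OF right_artinian sub ne] by blast
  have "H = right_multiples R M v"
    by (rule minimal_right_generates[OF H closed]) (use v in auto)
  then show ?thesis using v(1) by blast
qed

section \<open>Surjective endomorphisms have trivial kernel\<close>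

text \<open>
  The standard argument that Noetherian modules are Hopfian: the elements killed by some power of
  \<open>f\<close> form a principal submodule, so a single power of \<open>f\<close> kills all of them.
\<close>

lemma (in right_euclidean_module) surj_endomorphism_kernel:
  assumes N: "subgroup N (add_monoid M)"
    and closed: "\<And>x a. \<lbrakk>x \<in> N; a \<in> carrier R\<rbrakk> \<Longrightarrow> x \<odot>\<^sub>r\<^bsub>M\<^esub> a \<in> N"
    and add: "\<And>x y. \<lbrakk>x \<in> N; y \<in> N\<rbrakk> \<Longrightarrow> f (x \<oplus>\<^bsub>M\<^esub> y) = f x \<oplus>\<^bsub>M\<^esub> f y"
    and rsmult: "\<And>x a. \<lbrakk>x \<in> N; a \<in> carrier R\<rbrakk> \<Longrightarrow> f (x \<odot>\<^sub>r\<^bsub>M\<^esub> a) = f x \<odot>\<^sub>r\<^bsub>M\<^esub> a"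
    and surj: "f ` N = N"
    and x: "x \<in> N" "f x = \<zero>\<^bsub>M\<^esub>"
  shows "x = \<zero>\<^bsub>M\<^esub>"
proof -
  have sub: "y \<in> carrier M" if "y \<in> N" for y using subgroup.subset[OF N] that by auto
  have zeroN: "\<zero>\<^bsub>M\<^esub> \<in> N" using subgroup.one_closed[OF N] by simp
  have addN: "y \<oplus>\<^bsub>M\<^esub> z \<in> N" if "y \<in> N" "z \<in> N" for y z
    using subgroup.m_closed[OF N that] by simp
  have negN: "\<ominus>\<^bsub>M\<^esub> y \<in> N" if "y \<in> N" for y
    using M.add.subgroupE(3)[OF N that] .
  have pow_image: "(f ^^ m) ` N = N" for m
    by (induction m) (simp_all only: surj image_comp[symmetric] funpow.simps id_def image_ident)
  have powN: "(f ^^ m) y \<in> N" if "y \<in> N" for m y using pow_image that by blast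
  have pow_add: "(f ^^ m) (y \<oplus>\<^bsub>M\<^esub> z) = (f ^^ m) y \<oplus>\<^bsub>M\<^esub> (f ^^ m) z"
    if "y \<in> N" "z \<in> N" for m y z
    by (induction m) (simp_all add: add powN that)
  have pow_rsmult: "(f ^^ m) (y \<odot>\<^sub>r\<^bsub>M\<^esub> a) = (f ^^ m) y \<odot>\<^sub>r\<^bsub>M\<^esub> a"
    if "y \<in> N" "a \<in> carrier R" for m y a
    by (induction m) (simp_all add: rsmult powN that)
  have pow_zero: "(f ^^ m) \<zero>\<^bsub>M\<^esub> = \<zero>\<^bsub>M\<^esub>" for m
    using pow_rsmult[OF zeroN, of "\<zero>\<^bsub>R\<^esub>" m] pow_add[OF zeroN zeroN, of m]
      M.add.l_cancel_one' sub powN zeroN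
    by (metis M.l_zero M.zero_closed)
  have pow_later: "(f ^^ k) y = \<zero>\<^bsub>M\<^esub>" if "(f ^^ m) y = \<zero>\<^bsub>M\<^esub>" "m \<le> k" for m k y
  proof -
    have "(f ^^ k) y = (f ^^ (k - m)) ((f ^^ m) y)"
      using that(2) by (metis comp_apply funpow_add le_add_diff_inverse2)
    then show ?thesis using that(1) pow_zero by simp
  qed
  \<comment> \<open>\<open>U\<close> is the union of the ascending chain of kernels of the powers of
    \<open>f\<close>.\<close>
  define U where "U = {y \<in> N. \<exists>m. (f ^^ m) y = \<zero>\<^bsub>M\<^esub>}"
  have U: "subgroup U (add_monoid M)"
  proof (rule M.add.subgroupI)
    show "U \<subseteq> carrier M" using sub unfolding U_def by blast
    have "\<zero>\<^bsub>M\<^esub> \<in> U" using zeroN pow_zero unfolding U_def by blast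
    then show "U \<noteq> {}" by blast
  next
    fix y assume "y \<in> U"
    then obtain m where y: "y \<in> N" "(f ^^ m) y = \<zero>\<^bsub>M\<^esub>" unfolding U_def by blast
    have "(f ^^ m) y \<oplus>\<^bsub>M\<^esub> (f ^^ m) (\<ominus>\<^bsub>M\<^esub> y) = \<zero>\<^bsub>M\<^esub>"
      using pow_add[OF y(1) negN[OF y(1)], of m] M.r_neg[OF sub[OF y(1)]] pow_zero by simp
    then have "(f ^^ m) (\<ominus>\<^bsub>M\<^esub> y) = \<zero>\<^bsub>M\<^esub>"
      using y sub[OF powN[OF negN[OF y(1)]]] by simp
    then show "\<ominus>\<^bsub>M\<^esub> y \<in> U" using negN[OF y(1)] unfolding U_def by blast
  next
    fix y z assume "y \<in> U" "z \<in> U"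
    then obtain m k where y: "y \<in> N" "(f ^^ m) y = \<zero>\<^bsub>M\<^esub>" and z: "z \<in> N" "(f ^^ k) z = \<zero>\<^bsub>M\<^esub>"
      unfolding U_def by blast
    \<comment> \<open>A power that kills an element is followed only by powers that kill it, so the
      larger exponent works for both summands.\<close>
    have "(f ^^ max m k) (y \<oplus>\<^bsub>M\<^esub> z) = \<zero>\<^bsub>M\<^esub>"
      using pow_add[OF y(1) z(1)] pow_later[OF y(2), of "max m k"]
        pow_later[OF z(2), of "max m k"] by simp
    then show "y \<oplus>\<^bsub>M\<^esub> z \<in> U" using addN[OF y(1) z(1)] unfolding U_def by blast
  qed
  have closedU: "y \<odot>\<^sub>r\<^bsub>M\<^esub> a \<in> U" if "y \<in> U" "a \<in> carrier R" for y a
  proof -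
    obtain m where y: "y \<in> N" "(f ^^ m) y = \<zero>\<^bsub>M\<^esub>" using \<open>y \<in> U\<close> unfolding U_def by blast
    have "(f ^^ m) (y \<odot>\<^sub>r\<^bsub>M\<^esub> a) = \<zero>\<^bsub>M\<^esub>"
      using pow_rsmult[OF y(1) that(2), of m] y(2) rsmult_zero[OF that(2)] by simp
    then show ?thesis using closed[OF y(1) that(2)] unfolding U_def by blast
  qed
  obtain u where u: "u \<in> U" "U = right_multiples R M u"
    using right_submodule_generator[OF U closedU] by metis
  from u(1) obtain m where um: "u \<in> N" "(f ^^ m) u = \<zero>\<^bsub>M\<^esub>" unfolding U_def by blast
  \<comment> \<open>The exponent \<open>m\<close> was chosen for the generator \<open>u\<close>
    alone; it works for all of \<open>U\<close> because \<open>f ^^ m\<close> commutes with the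
    right action.\<close>
  have kill: "(f ^^ m) y = \<zero>\<^bsub>M\<^esub>" if "y \<in> U" for y
  proof -
    obtain a where a: "a \<in> carrier R" "y = u \<odot>\<^sub>r\<^bsub>M\<^esub> a"
      using equalityD1[OF u(2), THEN subsetD, OF \<open>y \<in> U\<close>] unfolding right_multiples_def by blast
    then show ?thesis using pow_rsmult[OF um(1) a(1), of m] um(2) rsmult_zero[OF a(1)] by simp
  qed
  \<comment> \<open>Surjectivity of \<open>f ^^ m\<close> lifts \<open>x\<close> to
    \<open>y\<close>. As \<open>f x\<close> is zero, \<open>y\<close> is killed by
    \<open>f ^^ Suc m\<close>, so it lies in \<open>U\<close> and already \<open>f ^^ m\<close>
    kills it; but that value is \<open>x\<close>.\<close>
  obtain y where y: "y \<in> N" "x = (f ^^ m) y" using x(1) pow_image[of m] by blast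
  have "(f ^^ Suc m) y = \<zero>\<^bsub>M\<^esub>" using x(2) y(2) by simp
  then have "y \<in> U" using y(1) unfolding U_def by blast
  then show ?thesis using kill y(2) by simp
qed

section \<open>Sub-bimodules and their cyclic generators\<close>

text \<open>All closure conditions pass to intersections. Nonemptiness of the family matters: the
  empty intersection is the whole type rather than \<open>carrier M\<close>.\<close>

lemma subbimodule_Inter:
  assumes "abelian_group M" "\<S> \<noteq> {}" "\<And>H. H \<in> \<S> \<Longrightarrow> subbimodule H R M"
  shows "subbimodule (\<Inter>\<S>) R M"
proof -
  have sg: "subgroup H (add_monoid M)" if "H \<in> \<S>" for H
    using subbimodule.axioms(1)[OF assms(3)[OF that]] by (simp add: submodule_def)
  have "subgroup (\<Inter>\<S>) (add_monoid M)"
    using group.subgroups_Inter[OF abelian_group.a_group[OF assms(1)]] assms(2) sg by blast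
  then show ?thesis
    using assms(3)
    by (auto simp: subbimodule_def submodule_def submodule_axioms_def subbimodule_axioms_def)
qed

context euclidean_bimodule
begin

lemma subbimodule_carrier: "subbimodule (carrier E) R E"
  using M.add.subgroup_self lsmult_closed right_module.rsmult_closed[OF right_module_axioms]
  by (simp add: subbimodule_def submodule_def submodule_axioms_def subbimodule_axioms_def)

text \<open>The carrier is itself a sub-bimodule containing \<open>a\<close>, so the defining
  intersection runs over a nonempty family.\<close>

lemma subbimodule_gen_subbimodule:
  assumes "a \<in> carrier E" shows "subbimodule (gen_subbimodule R E a) R E"
  unfolding gen_subbimodule_def
  by (rule subbimodule_Inter) (use assms subbimodule_carrier M.abelian_group_axioms in blast)+

text \<open>Both Euclidean structures use the same \<open>d\<close>, so a nonzero element of minimal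
  value generates \<open>N\<close> from the left and from the right at once.\<close>

lemma subbimodule_cyclic:
  assumes "subbimodule N R E"
  shows "\<exists>g. cyclic_generator R E N g"
proof -
  interpret N: subbimodule N R E by fact
  have sg: "subgroup N (add_monoid E)" by (rule N.subgroup_axioms)
  show ?thesis
  proof (cases "N = {\<zero>\<^bsub>E\<^esub>}")
    case True
    then have "cyclic_generator R E N \<zero>\<^bsub>E\<^esub>"
      unfolding cyclic_generator_def by (simp add: left_multiples_zero right_multiples_zero)
    then show ?thesis by blast
  next
    case False
    have "\<zero>\<^bsub>E\<^esub> \<in> N" using N.one_closed by simp
    with False have ne: "N - {\<zero>\<^bsub>E\<^esub>} \<noteq> {}" by auto
    have sub: "N - {\<zero>\<^bsub>E\<^esub>} \<subseteq> carrier E - {\<zero>\<^bsub>E\<^esub>}" using N.subset by auto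
    obtain v where v: "v \<in> N - {\<zero>\<^bsub>E\<^esub>}" "\<forall>x\<in>N - {\<zero>\<^bsub>E\<^esub>}. \<not> d x < d v"
      using artinian_poset_minimal[OF left_artinian sub ne] by blast
    have "N = left_multiples R E v"
      by (rule minimal_left_generates[OF sg N.smult_closed]) (use v in auto)
    moreover have "N = right_multiples R E v"
      by (rule minimal_right_generates[OF sg N.rsmult_closed]) (use v in auto)
    ultimately show ?thesis using v(1) unfolding cyclic_generator_def by blast
  qed
qed

text \<open>The universal property of a least common multiple speaks of left multiples only; this
  lemma supplies the right-hand half. A two-sided generator \<open>g\<close> is compared with
  \<open>l\<close>, and the scalars relating them act on \<open>N\<close> as mutually inverse
  maps.\<close>

lemma left_generator_is_cyclic_generator:
  assumes "subbimodule N R E" "l \<in> N" "N = left_multiples R E l"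
  shows "cyclic_generator R E N l"
proof -
  interpret N: subbimodule N R E by fact
  have sg: "subgroup N (add_monoid E)" by (rule N.subgroup_axioms)
  have sub: "x \<in> carrier E" if "x \<in> N" for x using N.subset that by auto
  obtain g where g: "g \<in> N" "N = left_multiples R E g" "N = right_multiples R E g"
    using subbimodule_cyclic[OF assms(1)] unfolding cyclic_generator_def by blast
  obtain \<alpha> where \<alpha>: "\<alpha> \<in> carrier R" "g = \<alpha> \<odot>\<^bsub>E\<^esub> l"
    using g(1) assms(3) unfolding left_multiples_def by auto
  obtain \<beta> where \<beta>: "\<beta> \<in> carrier R" "l = \<beta> \<odot>\<^bsub>E\<^esub> g"
    using assms(2) g(2) unfolding left_multiples_def by auto
  \<comment> \<open>First \<alpha>\<beta>g = \<alpha>l = g; since every element of \<open>N\<close>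
    is a right multiple of \<open>g\<close>, the bimodule law extends this to all of
    \<open>N\<close>.\<close>
  have inv: "\<alpha> \<odot>\<^bsub>E\<^esub> (\<beta> \<odot>\<^bsub>E\<^esub> x) = x" if "x \<in> N" for x
  proof -
    obtain r where r: "r \<in> carrier R" "x = g \<odot>\<^sub>r\<^bsub>E\<^esub> r"
      using \<open>x \<in> N\<close> g(3) unfolding right_multiples_def by auto
    then show ?thesis
      using \<alpha> \<beta> g(1) assms(2) sub lsmult_closed smult_rsmult_assoc by metis
  qed
  have surj: "(\<lambda>x. \<alpha> \<odot>\<^bsub>E\<^esub> x) ` N = N"
  proof
    show "(\<lambda>x. \<alpha> \<odot>\<^bsub>E\<^esub> x) ` N \<subseteq> N" using N.smult_closed[OF \<alpha>(1)] by blast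
    show "N \<subseteq> (\<lambda>x. \<alpha> \<odot>\<^bsub>E\<^esub> x) ` N"
      using inv N.smult_closed[OF \<beta>(1)] by (metis imageI subsetI)
  qed
  \<comment> \<open>By the bimodule law, left multiplication by \<alpha> is an endomorphism of the
    right module \<open>N\<close>, so the kernel result applies to it.\<close>
  have inj: "x = \<zero>\<^bsub>E\<^esub>" if "x \<in> N" "\<alpha> \<odot>\<^bsub>E\<^esub> x = \<zero>\<^bsub>E\<^esub>" for x
    by (rule surj_endomorphism_kernel[OF sg N.rsmult_closed _ _ surj that])
      (simp_all add: \<alpha>(1) sub lsmult_r_distr smult_rsmult_assoc)
  have inv': "\<beta> \<odot>\<^bsub>E\<^esub> (\<alpha> \<odot>\<^bsub>E\<^esub> x) = x" if x: "x \<in> N" for x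
  proof -
    let ?y = "\<beta> \<odot>\<^bsub>E\<^esub> (\<alpha> \<odot>\<^bsub>E\<^esub> x)"
    have y: "?y \<in> N" using N.smult_closed \<alpha>(1) \<beta>(1) x by blast
    have neg: "\<ominus>\<^bsub>E\<^esub> x \<in> N" using M.add.subgroupE(3)[OF sg x] .
    \<comment> \<open>Multiplication by \<alpha> kills the difference of \<beta>\<alpha>x and x,
      because \<alpha>\<beta> fixes \<alpha>x. Triviality of the kernel then makes the difference
      zero.\<close>
    have "\<alpha> \<odot>\<^bsub>E\<^esub> (?y \<oplus>\<^bsub>E\<^esub> \<ominus>\<^bsub>E\<^esub> x) = \<alpha> \<odot>\<^bsub>E\<^esub> ?y \<oplus>\<^bsub>E\<^esub> \<alpha> \<odot>\<^bsub>E\<^esub> (\<ominus>\<^bsub>E\<^esub> x)"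
      using lsmult_r_distr \<alpha>(1) sub y neg by blast
    also have "\<dots> = \<alpha> \<odot>\<^bsub>E\<^esub> x \<oplus>\<^bsub>E\<^esub> \<alpha> \<odot>\<^bsub>E\<^esub> (\<ominus>\<^bsub>E\<^esub> x)"
      using inv[OF N.smult_closed[OF \<alpha>(1) x]] by simp
    also have "\<dots> = \<zero>\<^bsub>E\<^esub>"
      using lsmult_r_distr[OF \<alpha>(1) sub[OF x] sub[OF neg]] M.r_neg[OF sub[OF x]]
        lsmult_zero[OF \<alpha>(1)] by simp
    finally have "?y \<oplus>\<^bsub>E\<^esub> \<ominus>\<^bsub>E\<^esub> x = \<zero>\<^bsub>E\<^esub>"
      using inj subgroup.m_closed[OF sg y neg] by simp
    then show ?thesis using M.minus_equality[of ?y] M.minus_minus sub x y neg by metis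
  qed
  have "N \<subseteq> right_multiples R E l"
  proof
    fix x assume x: "x \<in> N"
    then obtain r where r: "r \<in> carrier R" "\<alpha> \<odot>\<^bsub>E\<^esub> x = g \<odot>\<^sub>r\<^bsub>E\<^esub> r"
      using N.smult_closed[OF \<alpha>(1)] g(3) unfolding right_multiples_def by blast
    \<comment> \<open>Here x = \<beta>\<alpha>x = \<beta>(gr) = (\<beta>g)r = lr.\<close>
    then have "x = l \<odot>\<^sub>r\<^bsub>E\<^esub> r"
      using inv'[OF x] \<beta> sub[OF g(1)] smult_rsmult_assoc by metis
    with r(1) show "x \<in> right_multiples R E l" unfolding right_multiples_def by blast
  qed
  moreover have "right_multiples R E l \<subseteq> N"
    using N.rsmult_closed assms(2) unfolding right_multiples_def by blast
  ultimately show ?thesis using assms(2,3) unfolding cyclic_generator_def by blast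
qed

end

section \<open>Characterization of bimodule least common multiples\<close>

theorem proposition4p17:
  fixes R :: "('a, 'r) ring_scheme"
    and E :: "('a, 'b, 'm) bimodule_scheme"
    and d :: "'b \<Rightarrow> 'p::order"
    and n :: nat
    and a :: "nat \<Rightarrow> 'b"
    and l :: 'b
  assumes "euclidean_bimodule R E d"
    and "n \<ge> 1"
    and "\<And>i. i \<in> {1..n} \<Longrightarrow> a i \<in> carrier E"
    and "l \<in> carrier E"
  shows "is_bimodule_lcm R E n a l \<longleftrightarrow>
    (\<forall>i\<in>{1..n}. l \<in> gen_subbimodule R E (a i)) \<and>
    (\<forall>l'. cyclic_element R E l' \<and> (\<forall>i\<in>{1..n}. l' \<in> gen_subbimodule R E (a i))
      \<longrightarrow> (\<exists>\<alpha>\<in>carrier R. l' = \<alpha> \<odot>\<^bsub>E\<^esub> l))"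
proof -
  interpret euclidean_bimodule R E d by fact
  define N where "N = (\<Inter>i\<in>{1..n}. gen_subbimodule R E (a i))"
  have N: "subbimodule N R E"
    unfolding N_def
    \<comment> \<open>The hypothesis that \<open>n\<close> is at least 1 makes the intersected
      family nonempty.\<close>
    by (rule subbimodule_Inter)
      (use assms(2,3) subbimodule_gen_subbimodule M.abelian_group_axioms in auto)
  then have NE: "N \<subseteq> carrier E"
    using subgroup.subset[of N "add_monoid E"] by (simp add: subbimodule_def submodule_def)
  have "cyclic_generator R E N l \<longleftrightarrow>
    l \<in> N \<and> (\<forall>l'. cyclic_element R E l' \<and> l' \<in> N \<longrightarrow> (\<exists>\<alpha>\<in>carrier R. l' = \<alpha> \<odot>\<^bsub>E\<^esub> l))"
    (is "?lcm \<longleftrightarrow> ?universal")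
  proof
    assume ?lcm
    then show ?universal unfolding cyclic_generator_def left_multiples_def by blast
  next
    assume universal: ?universal
    obtain g where g: "g \<in> N" "N = left_multiples R E g" "N = right_multiples R E g"
      using subbimodule_cyclic[OF N] unfolding cyclic_generator_def by blast
    \<comment> \<open>The universal property tests cyclic elements only, so a two-sided generator of
      \<open>N\<close> is the element to apply it to.\<close>
    then have "cyclic_element R E g" using NE unfolding cyclic_element_def by blast
    with universal g(1) obtain \<alpha> where \<alpha>: "\<alpha> \<in> carrier R" "g = \<alpha> \<odot>\<^bsub>E\<^esub> l" by blast
    have "N \<subseteq> left_multiples R E l"
    proof
      fix x assume "x \<in> N"
      then obtain r where r: "r \<in> carrier R" "x = r \<odot>\<^bsub>E\<^esub> g"
        using g(2) unfolding left_multiples_def by blast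
      then have "x = (r \<otimes>\<^bsub>R\<^esub> \<alpha>) \<odot>\<^bsub>E\<^esub> l" using \<alpha> assms(4) by (simp add: lsmult_assoc)
      with r(1) \<alpha>(1) show "x \<in> left_multiples R E l" unfolding left_multiples_def by blast
    qed
    moreover have "left_multiples R E l \<subseteq> N"
      using universal submodule.smult_closed[OF subbimodule.axioms(1)[OF N]]
      unfolding left_multiples_def by blast
    ultimately show ?lcm
      using left_generator_is_cyclic_generator[OF N] universal by blast
  qed
  then show ?thesis unfolding is_bimodule_lcm_def N_def by simp
qed

end
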